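(* Consider the scalar control system under no attack described in the context, with LQG cost weights $W,U>0$. Let $\Delta LQG=J_w-J_n$ be the increase in LQG cost from the optimal LQG cost $J_n$ (attained with $u_k=L\hat x_{k|k}$) to the cost $J_w$ attained with the watermarked control $u_k=L\hat x_{k|k}+e_k$, where the watermarking signal $e_k$ has variance $\sigma_e^2$. Then the watermarking signal variance is related to the increase in LQG cost by $$\sigma_e^2=\frac{\Delta LQG}{U+\dfrac{B^2(W+L^2U)}{1-(A+BL)^2}}.$$
   Context: All quantities are real scalars. System: $x_{k+1}=Ax_k+Bu_k+w_k$, $y_k=Cx_k+v_k$, with $B,C\neq 0$, where $w_k\sim\mathcal N(0,Q)$ is i.i.d., $v_k\sim\mathcal N(0,R)$ is i.i.d. and independent of the process noise, and $Q,R>0$. The system started at time $-\infty$ and is in steady state; it is stabilizable and detectable. There is no attack: the controller receives the true measurements $y_k$. Steady-state Kalman filter: $\hat x_{k+1|k}=A\hat x_{k|k}+Bu_k$, $\hat x_{k|k}=\hat x_{k|k-1}+K\gamma_k$, with innovation $\gamma_k=y_k-C\hat x_{k|k-1}$ and gain $K=\frac{CP}{C^2P+R}$, where $P>0$ is the steady-state error variance $E(x_k-\hat x_{k|k-1})^2$ and solves $P=A^2P+Q-A^2C^2P^2(C^2P+R)^{-1}$. Here $\hat x_{k+1|k}$ and $\hat x_{k|k}$ are the conditional expectations of $x_{k+1}$ and $x_k$ given the measurements up to time $k$ (the controls being known to the estimator). LQG cost: $J=\lim_{T\to\infty}E\,\frac{1}{2T+1}\Big[\sum_{k=-T}^{T}(Wx_k^2+Uu_k^2)\Big]$.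 The optimal LQG control (without watermarking) is $u_k=L\hat x_{k|k}$ with $L=\frac{-ABS}{B^2S+U}$, where $S>0$ solves $S=A^2S+W-A^2B^2S^2(B^2S+U)^{-1}$. Watermarking: $(e_k)$ is an i.i.d. zero-mean Gaussian sequence with variance $\sigma_e^2$, independent of the process and measurement noises. *)

theory Defs
  imports "HOL-Probability.Probability"
begin

(* Zero-mean Gaussian with variance s2 \<ge> 0; variance 0 is the point mass at 0, for which
   no density with respect to Lebesgue measure exists. *)
definition gaussian_rv :: "'a measure \<Rightarrow> ('a \<Rightarrow> real) \<Rightarrow> real \<Rightarrow> bool" where
  "gaussian_rv M X s2 \<longleftrightarrow>
     X \<in> borel_measurable M \<and> 0 \<le> s2 \<and>
     (if s2 = 0 then (AE \<omega> in M. X \<omega> = 0)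
      else distributed M lborel X (normal_density 0 (sqrt s2)))"

(* The three sequences are joined over the disjoint union of their index sets, so that a single
   independence statement covers independence within each sequence and between the sequences. *)
definition lqg_noises ::
  "'a measure \<Rightarrow> real \<Rightarrow> real \<Rightarrow> real \<Rightarrow>
   (int \<Rightarrow> 'a \<Rightarrow> real) \<Rightarrow> (int \<Rightarrow> 'a \<Rightarrow> real) \<Rightarrow> (int \<Rightarrow> 'a \<Rightarrow> real) \<Rightarrow> bool" where
  "lqg_noises M Q R s2 w v e \<longleftrightarrow>
     (\<forall>k. gaussian_rv M (w k) Q) \<and>
     (\<forall>k. gaussian_rv M (v k) R) \<and>
     (\<forall>k. gaussian_rv M (e k) s2) \<and>
     prob_space.indep_vars M (\<lambda>_. borel) (case_sum w (case_sum v e)) UNIV"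

definition stabilizable :: "real \<Rightarrow> real \<Rightarrow> bool" where
  "stabilizable A B \<longleftrightarrow> (\<exists>F. \<bar>A + B * F\<bar> < 1)"

definition detectable :: "real \<Rightarrow> real \<Rightarrow> bool" where
  "detectable A C \<longleftrightarrow> (\<exists>G. \<bar>A - G * C\<bar> < 1)"

definition kalman_gain :: "real \<Rightarrow> real \<Rightarrow> real \<Rightarrow> real" where
  "kalman_gain C R P = C * P / (C\<^sup>2 * P + R)"

definition lqg_gain :: "real \<Rightarrow> real \<Rightarrow> real \<Rightarrow> real \<Rightarrow> real" where
  "lqg_gain A B U S = - (A * B * S) / (B\<^sup>2 * S + U)"

(* Sigma-algebra generated by the measurements up to time m and the controls up to time n. *)
definition observations ::
  "'a measure \<Rightarrow> (int \<Rightarrow> 'a \<Rightarrow> real) \<Rightarrow> (int \<Rightarrow> 'a \<Rightarrow> real) \<Rightarrow> int \<Rightarrow> int \<Rightarrow> 'a measure" where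
  "observations M y u m n = sigma (space M)
     ({y j -` D \<inter> space M | j D. j \<le> m \<and> D \<in> sets borel} \<union>
      {u j -` D \<inter> space M | j D. j \<le> n \<and> D \<in> sets borel})"

(* The plant driven by an arbitrary control u, together with its steady-state Kalman filter,
   running since time minus infinity: xp k is the one-step prediction of x k from the data up to
   time k - 1, and xf k is the filtered estimate of x k from the data up to time k.  Steady state
   means that the state (x k, xp k) of plant and filter has finite second moments and a
   distribution that does not depend on k.  The system equations hold almost surely, as the
   conditional expectations are only determined up to null sets. *)
definition steady_state_loop ::
  "'a measure \<Rightarrow> real \<Rightarrow> real \<Rightarrow> real \<Rightarrow> real \<Rightarrow> real \<Rightarrow>
   (int \<Rightarrow> 'a \<Rightarrow> real) \<Rightarrow> (int \<Rightarrow> 'a \<Rightarrow> real) \<Rightarrow>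
   (int \<Rightarrow> 'a \<Rightarrow> real) \<Rightarrow> (int \<Rightarrow> 'a \<Rightarrow> real) \<Rightarrow> (int \<Rightarrow> 'a \<Rightarrow> real) \<Rightarrow>
   (int \<Rightarrow> 'a \<Rightarrow> real) \<Rightarrow> (int \<Rightarrow> 'a \<Rightarrow> real) \<Rightarrow> bool" where
  "steady_state_loop M A B C R P w v x y u xp xf \<longleftrightarrow>
     (\<forall>k. x k \<in> borel_measurable M \<and> y k \<in> borel_measurable M \<and> u k \<in> borel_measurable M \<and>
          xp k \<in> borel_measurable M \<and> xf k \<in> borel_measurable M) \<and>
     (\<forall>k. AE \<omega> in M. x (k + 1) \<omega> = A * x k \<omega> + B * u k \<omega> + w k \<omega>) \<and>
     (\<forall>k. AE \<omega> in M. y k \<omega> = C * x k \<omega> + v k \<omega>) \<and>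
     (\<forall>k. AE \<omega> in M. xp (k + 1) \<omega> = A * xf k \<omega> + B * u k \<omega>) \<and>
     (\<forall>k. AE \<omega> in M. xf k \<omega> = xp k \<omega> + kalman_gain C R P * (y k \<omega> - C * xp k \<omega>)) \<and>
     (\<forall>k. AE \<omega> in M. xp (k + 1) \<omega> = real_cond_exp M (observations M y u k k) (x (k + 1)) \<omega>) \<and>
     (\<forall>k. AE \<omega> in M. xf k \<omega> = real_cond_exp M (observations M y u k (k - 1)) (x k) \<omega>) \<and>
     (\<forall>k. integrable M (\<lambda>\<omega>. (x k \<omega>)\<^sup>2) \<and> integrable M (\<lambda>\<omega>. (xp k \<omega>)\<^sup>2)) \<and>
     (\<forall>k. distr M (borel \<Otimes>\<^sub>M borel) (\<lambda>\<omega>. (x k \<omega>, xp k \<omega>)) =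
          distr M (borel \<Otimes>\<^sub>M borel) (\<lambda>\<omega>. (x 0 \<omega>, xp 0 \<omega>))) \<and>
     (\<forall>k. (\<integral>\<omega>. (x k \<omega> - xp k \<omega>)\<^sup>2 \<partial>M) = P)"

definition lqg_average_cost ::
  "'a measure \<Rightarrow> real \<Rightarrow> real \<Rightarrow> (int \<Rightarrow> 'a \<Rightarrow> real) \<Rightarrow> (int \<Rightarrow> 'a \<Rightarrow> real) \<Rightarrow> nat \<Rightarrow> real" where
  "lqg_average_cost M W U x u T =
     (\<integral>\<omega>. 1 / (2 * real T + 1) *
        (\<Sum>k = - int T..int T. W * (x k \<omega>)\<^sup>2 + U * (u k \<omega>)\<^sup>2) \<partial>M)"

definition lqg_cost ::
  "'a measure \<Rightarrow> real \<Rightarrow> real \<Rightarrow> (int \<Rightarrow> 'a \<Rightarrow> real) \<Rightarrow> (int \<Rightarrow> 'a \<Rightarrow> real) \<Rightarrow> real" where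
  "lqg_cost M W U x u = lim (lqg_average_cost M W U x u)"

end

theory Submission
  imports Defs
begin

text \<open>
  The theorem is a superposition argument.  Write \<open>a = A (1 - K C)\<close> for the error pole of the filter
  and \<open>F = A + B L\<close> for the pole of the controlled plant; the two Riccati equations force
  \<open>a\<^sup>2 < 1\<close> and \<open>F\<^sup>2 < 1\<close>.  The prediction error \<open>d = x - xp\<close> satisfies
  \<open>d (k + 1) = a d k + (w k - A K v k)\<close>, a recursion that the control does not enter.  The errors of
  the two loops therefore differ by a mean-square bounded solution of \<open>g (k + 1) = a g k\<close> running
  since minus infinity, and such a solution vanishes.  Hence the watermarked loop equals the nominal one plus the
  response \<open>r\<close> of the plant to the watermark alone:
  \<open>x\<^sub>w = x\<^sub>n + r\<close>, \<open>u\<^sub>w = u\<^sub>n + L r + e\<close> and \<open>r (k + 1) = F r k + B e k\<close>.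

  The nominal loop is driven by \<open>w\<close> and \<open>v\<close>, so it is uncorrelated with \<open>e\<close> and with \<open>r\<close>, and the
  costs add.  The stationary solution of the recursion of \<open>r\<close> has second moment
  \<open>B\<^sup>2 \<sigma>\<^sub>e\<^sup>2 / (1 - F\<^sup>2)\<close>, and the present watermark sample \<open>e k\<close> is uncorrelated with \<open>r k\<close>.
  Thus each stage costs \<open>(W + L\<^sup>2 U) B\<^sup>2 \<sigma>\<^sub>e\<^sup>2 / (1 - F\<^sup>2) + U \<sigma>\<^sub>e\<^sup>2\<close> more than in the nominal loop.

  All these claims rest on one remark, \<open>bounded_contraction_since_minus_infinity\<close>: it yields
  the equality of the errors, the variance of \<open>r\<close>, and the vanishing of the correlations, for which
  it takes the place of an explicit causality condition on the states.
\<close>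

section \<open>Bounded solutions of stable recursions\<close>

text \<open>The value at \<open>k\<close> is \<open>a ^ n\<close> times the value \<open>n\<close> steps earlier, which stays bounded.\<close>

lemma bounded_contraction_since_minus_infinity:
  fixes f :: "int \<Rightarrow> real"
  assumes rec: "\<And>j. j < k \<Longrightarrow> f (j + 1) = a * f j"
    and a: "\<bar>a\<bar> < 1"
    and bound: "\<And>j. \<bar>f j\<bar> \<le> b"
  shows "f k = 0"
proof -
  have pow: "f k = a ^ n * f (k - int n)" for n
  proof (induction n)
    case (Suc n)
    have "f (k - int n) = a * f (k - int (Suc n))"
      using rec[of "k - int (Suc n)"] by simp
    then show ?case using Suc by simp
  qed simp
  have "\<bar>f k\<bar> \<le> \<bar>a\<bar> ^ n * b" for n
  proof -
    have "\<bar>f k\<bar> = \<bar>a\<bar> ^ n * \<bar>f (k - int n)\<bar>"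
      using arg_cong[OF pow[of n], of abs] by (simp add: abs_mult power_abs)
    also have "\<dots> \<le> \<bar>a\<bar> ^ n * b"
      by (rule mult_left_mono[OF bound]) simp
    finally show ?thesis .
  qed
  moreover have "(\<lambda>n. \<bar>a\<bar> ^ n * b) \<longlonglongrightarrow> 0 * b"
    by (intro tendsto_mult_right LIMSEQ_power_zero) (use a in simp)
  ultimately have "\<bar>f k\<bar> \<le> 0"
    by (intro LIMSEQ_le_const) auto
  then show ?thesis by simp
qed

section \<open>Square-integrable random variables\<close>

definition square_integrable :: "'a measure \<Rightarrow> ('a \<Rightarrow> real) \<Rightarrow> bool" where
  "square_integrable M X \<longleftrightarrow> X \<in> borel_measurable M \<and> integrable M (\<lambda>\<omega>. (X \<omega>)\<^sup>2)"

lemma abs_mult_le_sum_squares: "\<bar>x * y\<bar> \<le> x\<^sup>2 + y\<^sup>2" for x y :: real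
proof -
  have "0 \<le> (\<bar>x\<bar> - \<bar>y\<bar>)\<^sup>2" by simp
  then have "2 * (\<bar>x\<bar> * \<bar>y\<bar>) \<le> x\<^sup>2 + y\<^sup>2" by (simp add: power2_diff)
  moreover have "0 \<le> \<bar>x\<bar> * \<bar>y\<bar>" by simp
  ultimately show ?thesis unfolding abs_mult by linarith
qed

lemma square_diff_le_twice_squares: "(x - y)\<^sup>2 \<le> 2 * x\<^sup>2 + 2 * y\<^sup>2" for x y :: real
proof -
  have "0 \<le> (x + y)\<^sup>2" by simp
  then show ?thesis by (simp add: power2_sum power2_diff)
qed

lemma square_integrable_mult_integrable:
  assumes "square_integrable M X" "square_integrable M Y"
  shows "integrable M (\<lambda>\<omega>. X \<omega> * Y \<omega>)"
proof (rule Bochner_Integration.integrable_bound)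
  show "integrable M (\<lambda>\<omega>. (X \<omega>)\<^sup>2 + (Y \<omega>)\<^sup>2)"
    using assms by (simp add: square_integrable_def)
  show "(\<lambda>\<omega>. X \<omega> * Y \<omega>) \<in> borel_measurable M"
    using assms by (auto simp: square_integrable_def)
  show "AE \<omega> in M. norm (X \<omega> * Y \<omega>) \<le> norm ((X \<omega>)\<^sup>2 + (Y \<omega>)\<^sup>2)"
    using abs_mult_le_sum_squares by simp
qed

lemma abs_integral_mult_le:
  assumes "square_integrable M X" "square_integrable M Y"
  shows "\<bar>\<integral>\<omega>. X \<omega> * Y \<omega> \<partial>M\<bar> \<le> (\<integral>\<omega>. (X \<omega>)\<^sup>2 \<partial>M) + (\<integral>\<omega>. (Y \<omega>)\<^sup>2 \<partial>M)"
proof -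
  have "\<bar>\<integral>\<omega>. X \<omega> * Y \<omega> \<partial>M\<bar> \<le> (\<integral>\<omega>. \<bar>X \<omega> * Y \<omega>\<bar> \<partial>M)"
    by (rule integral_abs_bound)
  also have "\<dots> \<le> (\<integral>\<omega>. (X \<omega>)\<^sup>2 + (Y \<omega>)\<^sup>2 \<partial>M)"
    using square_integrable_mult_integrable[OF assms] assms
    by (intro integral_mono) (auto simp: square_integrable_def abs_mult_le_sum_squares)
  also have "\<dots> = (\<integral>\<omega>. (X \<omega>)\<^sup>2 \<partial>M) + (\<integral>\<omega>. (Y \<omega>)\<^sup>2 \<partial>M)"
    using assms by (simp add: square_integrable_def)
  finally show ?thesis .
qed

lemma square_integrable_cmult:
  "square_integrable M X \<Longrightarrow> square_integrable M (\<lambda>\<omega>. c * X \<omega>)"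
  by (auto simp: square_integrable_def power_mult_distrib)

lemma square_integrable_add:
  assumes "square_integrable M X" "square_integrable M Y"
  shows "square_integrable M (\<lambda>\<omega>. X \<omega> + Y \<omega>)"
  using assms square_integrable_mult_integrable[OF assms]
  by (auto simp: square_integrable_def power2_sum mult.assoc)

lemma square_integrable_diff:
  assumes "square_integrable M X" "square_integrable M Y"
  shows "square_integrable M (\<lambda>\<omega>. X \<omega> - Y \<omega>)"
  using square_integrable_add[OF assms(1) square_integrable_cmult[OF assms(2), of "-1"]] by simp

lemma square_integrable_cong_AE:
  assumes "square_integrable M X" "Y \<in> borel_measurable M" "AE \<omega> in M. Y \<omega> = X \<omega>"
  shows "square_integrable M Y"
proof -
  have "integrable M (\<lambda>\<omega>. (Y \<omega>)\<^sup>2) = integrable M (\<lambda>\<omega>. (X \<omega>)\<^sup>2)"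
    using assms by (intro integrable_cong_AE) (auto simp: square_integrable_def)
  then show ?thesis using assms by (simp add: square_integrable_def)
qed

lemma integral_square_add:
  assumes "square_integrable M X" "square_integrable M Y"
  shows "(\<integral>\<omega>. (X \<omega> + Y \<omega>)\<^sup>2 \<partial>M)
    = (\<integral>\<omega>. (X \<omega>)\<^sup>2 \<partial>M) + 2 * (\<integral>\<omega>. X \<omega> * Y \<omega> \<partial>M) + (\<integral>\<omega>. (Y \<omega>)\<^sup>2 \<partial>M)"
  using assms square_integrable_mult_integrable[OF assms]
  by (simp add: square_integrable_def power2_sum mult.assoc)

lemma integral_lincomb_mult:
  assumes "square_integrable M X" "square_integrable M Y" "square_integrable M G"
  shows "(\<integral>\<omega>. (a * X \<omega> + b * Y \<omega>) * G \<omega> \<partial>M)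
    = a * (\<integral>\<omega>. X \<omega> * G \<omega> \<partial>M) + b * (\<integral>\<omega>. Y \<omega> * G \<omega> \<partial>M)"
  using assms square_integrable_mult_integrable[of M _ G]
  by (simp add: distrib_right mult.assoc)

lemma integral_square_cong_AE:
  fixes X Y :: "'a \<Rightarrow> real"
  assumes "X \<in> borel_measurable M" "Y \<in> borel_measurable M" "AE \<omega> in M. X \<omega> = Y \<omega>"
  shows "(\<integral>\<omega>. (X \<omega>)\<^sup>2 \<partial>M) = (\<integral>\<omega>. (Y \<omega>)\<^sup>2 \<partial>M)"
  using assms by (intro integral_cong_AE) auto

section \<open>Stationary second moments of stable recursions\<close>

text \<open>
  Causality without assuming it: a state with bounded second moments that has evolved stably
  since minus infinity is uncorrelated with everything that its past inputs are uncorrelated with.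
\<close>

lemma stable_recursion_uncorrelated:
  assumes Z: "\<And>j. square_integrable M (Z j)"
    and N: "\<And>j. square_integrable M (N j)"
    and G: "square_integrable M G"
    and rec: "\<And>j. AE \<omega> in M. Z (j + 1) \<omega> = a * Z j \<omega> + N j \<omega>"
    and a: "\<bar>a\<bar> < 1"
    and bound: "\<And>j. (\<integral>\<omega>. (Z j \<omega>)\<^sup>2 \<partial>M) \<le> b"
    and NG: "\<And>j. j < (k::int) \<Longrightarrow> (\<integral>\<omega>. N j \<omega> * G \<omega> \<partial>M) = 0"
  shows "(\<integral>\<omega>. Z k \<omega> * G \<omega> \<partial>M) = 0"
proof (rule bounded_contraction_since_minus_infinity[where a = a])
  show "\<bar>a\<bar> < 1" by (rule a)
  show "\<bar>\<integral>\<omega>. Z j \<omega> * G \<omega> \<partial>M\<bar> \<le> b + (\<integral>\<omega>. (G \<omega>)\<^sup>2 \<partial>M)" for j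
    using abs_integral_mult_le[OF Z[of j] G] bound[of j] by linarith
  fix j assume j: "j < k"
  have meas: "Z (j + 1) \<in> borel_measurable M" "Z j \<in> borel_measurable M"
    "N j \<in> borel_measurable M" "G \<in> borel_measurable M"
    using Z N G by (auto simp: square_integrable_def)
  have "(\<integral>\<omega>. Z (j + 1) \<omega> * G \<omega> \<partial>M) = (\<integral>\<omega>. (a * Z j \<omega> + 1 * N j \<omega>) * G \<omega> \<partial>M)"
    using meas rec[of j] by (intro integral_cong_AE) auto
  also have "\<dots> = a * (\<integral>\<omega>. Z j \<omega> * G \<omega> \<partial>M)"
    using integral_lincomb_mult[OF Z[of j] N[of j] G, of a 1] NG[OF j] by simp
  finally show "(\<integral>\<omega>. Z (j + 1) \<omega> * G \<omega> \<partial>M) = a * (\<integral>\<omega>. Z j \<omega> * G \<omega> \<partial>M)" .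
qed

text \<open>Uniqueness of the stationary solution, applied to the difference of two solutions.\<close>

lemma stable_homogeneous_recursion_zero:
  assumes Z: "\<And>j. square_integrable M (Z j)"
    and rec: "\<And>j::int. AE \<omega> in M. Z (j + 1) \<omega> = a * Z j \<omega>"
    and a: "\<bar>a\<bar> < 1"
    and bound: "\<And>j. (\<integral>\<omega>. (Z j \<omega>)\<^sup>2 \<partial>M) \<le> b"
  shows "AE \<omega> in M. Z k \<omega> = 0"
proof -
  have "(\<integral>\<omega>. Z k \<omega> * Z k \<omega> \<partial>M) = 0"
    by (rule stable_recursion_uncorrelated[where N = "\<lambda>_ _. 0" and a = a and b = b])
      (use Z rec a bound in \<open>auto simp: square_integrable_def\<close>)
  then have "(\<integral>\<omega>. (Z k \<omega>)\<^sup>2 \<partial>M) = 0" by (simp add: power2_eq_square)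
  then show ?thesis
    using Z[of k] integral_nonneg_eq_0_iff_AE[of M "\<lambda>\<omega>. (Z k \<omega>)\<^sup>2"]
    by (simp add: square_integrable_def)
qed

text \<open>
  The right-hand side is the fixed point of the second-moment recursion \<open>m \<mapsto> F\<^sup>2 m + B\<^sup>2 s2\<close>, and the
  deviation from it is itself a bounded contraction running since minus infinity.
\<close>

lemma white_noise_response_second_moment:
  assumes r: "\<And>j. square_integrable M (r j)"
    and e: "\<And>j. square_integrable M (e j)"
    and rec: "\<And>j::int. AE \<omega> in M. r (j + 1) \<omega> = F * r j \<omega> + B * e j \<omega>"
    and F: "\<bar>F\<bar> < 1"
    and bound: "\<And>j. (\<integral>\<omega>. (r j \<omega>)\<^sup>2 \<partial>M) \<le> b"
    and var: "\<And>j. (\<integral>\<omega>. (e j \<omega>)\<^sup>2 \<partial>M) = s2"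
    and re: "\<And>j. (\<integral>\<omega>. r j \<omega> * e j \<omega> \<partial>M) = 0"
  shows "(\<integral>\<omega>. (r k \<omega>)\<^sup>2 \<partial>M) = B\<^sup>2 * s2 / (1 - F\<^sup>2)"
proof -
  define m where "m = B\<^sup>2 * s2 / (1 - F\<^sup>2)"
  have F2: "F\<^sup>2 < 1" using F by (simp add: abs_square_less_1)
  have "(\<integral>\<omega>. (r k \<omega>)\<^sup>2 \<partial>M) - m = 0"
  proof (rule bounded_contraction_since_minus_infinity[where a = "F\<^sup>2"])
    show "\<bar>F\<^sup>2\<bar> < 1" using F2 by simp
    show "\<bar>(\<integral>\<omega>. (r j \<omega>)\<^sup>2 \<partial>M) - m\<bar> \<le> b + \<bar>m\<bar>" for j
    proof -
      have "0 \<le> (\<integral>\<omega>. (r j \<omega>)\<^sup>2 \<partial>M)" by simp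
      then show ?thesis using bound[of j] by linarith
    qed
    fix j
    have meas: "r (j + 1) \<in> borel_measurable M" "r j \<in> borel_measurable M" "e j \<in> borel_measurable M"
      using r e by (auto simp: square_integrable_def)
    have cross: "(\<integral>\<omega>. (F * r j \<omega>) * (B * e j \<omega>) \<partial>M) = 0"
    proof -
      have "(\<lambda>\<omega>. (F * r j \<omega>) * (B * e j \<omega>)) = (\<lambda>\<omega>. (F * B) * (r j \<omega> * e j \<omega>))"
        by (simp add: fun_eq_iff)
      then show ?thesis using re[of j] by simp
    qed
    have "(\<integral>\<omega>. (r (j + 1) \<omega>)\<^sup>2 \<partial>M) = (\<integral>\<omega>. (F * r j \<omega> + B * e j \<omega>)\<^sup>2 \<partial>M)"
      using meas rec[of j] by (intro integral_square_cong_AE) auto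
    also have "\<dots> = F\<^sup>2 * (\<integral>\<omega>. (r j \<omega>)\<^sup>2 \<partial>M) + B\<^sup>2 * s2"
      using integral_square_add[OF square_integrable_cmult[OF r[of j], of F]
          square_integrable_cmult[OF e[of j], of B]] cross var[of j]
      by (simp add: power_mult_distrib)
    also have "B\<^sup>2 * s2 = (1 - F\<^sup>2) * m" using F2 by (simp add: m_def)
    finally show "(\<integral>\<omega>. (r (j + 1) \<omega>)\<^sup>2 \<partial>M) - m = F\<^sup>2 * ((\<integral>\<omega>. (r j \<omega>)\<^sup>2 \<partial>M) - m)"
      by (simp add: algebra_simps)
  qed
  then show ?thesis by (simp add: m_def)
qed

section \<open>Second moments of the noises\<close>

lemma (in prob_space) gaussian_rv_moments:
  assumes "gaussian_rv M X s2"
  shows "square_integrable M X" "expectation X = 0" "expectation (\<lambda>\<omega>. (X \<omega>)\<^sup>2) = s2"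
proof -
  have X: "X \<in> borel_measurable M" using assms by (simp add: gaussian_rv_def)
  have "square_integrable M X \<and> expectation X = 0 \<and> expectation (\<lambda>\<omega>. (X \<omega>)\<^sup>2) = s2"
  proof (cases "s2 = 0")
    case True
    then have ae: "AE \<omega> in M. X \<omega> = 0" using assms by (simp add: gaussian_rv_def)
    have "square_integrable M X"
      by (rule square_integrable_cong_AE[where X = "\<lambda>_. 0"])
        (use X ae in \<open>auto simp: square_integrable_def\<close>)
    moreover have "expectation X = expectation (\<lambda>_. 0)"
      using X ae by (intro integral_cong_AE) auto
    moreover have "expectation (\<lambda>\<omega>. (X \<omega>)\<^sup>2) = expectation (\<lambda>_. 0\<^sup>2)"
      using X ae by (intro integral_square_cong_AE) auto
    ultimately show ?thesis using True by simp
  next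
    case False
    then have pos: "0 < sqrt s2" and D: "distributed M lborel X (normal_density 0 (sqrt s2))"
      using assms by (auto simp: gaussian_rv_def)
    have "integrable M (\<lambda>\<omega>. (X \<omega>)\<^sup>2)"
      using distributed_integrable[OF D, of "\<lambda>x. x\<^sup>2"] integrable_normal_moment[OF pos, of 0 2]
      by simp
    moreover have mean: "expectation X = 0"
      by (rule normal_distributed_expectation[OF pos D])
    moreover have "expectation (\<lambda>\<omega>. (X \<omega>)\<^sup>2) = s2"
      using normal_distributed_variance[OF pos D] mean pos by simp
    ultimately show ?thesis using X by (simp add: square_integrable_def)
  qed
  then show "square_integrable M X" "expectation X = 0" "expectation (\<lambda>\<omega>. (X \<omega>)\<^sup>2) = s2"
    by auto
qed

lemma (in prob_space) indep_centered_uncorrelated: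
  fixes X :: "'i \<Rightarrow> 'a \<Rightarrow> real"
  assumes "indep_vars (\<lambda>_. borel) X I" "i \<in> I" "j \<in> I" "i \<noteq> j"
    and "integrable M (X i)" "integrable M (X j)" "expectation (X j) = 0"
  shows "expectation (\<lambda>\<omega>. X i \<omega> * X j \<omega>) = 0"
proof -
  have "indep_vars (\<lambda>_. borel) X {i, j}"
    using assms(1) by (rule indep_vars_subset) (use assms in auto)
  then have "expectation (\<lambda>\<omega>. \<Prod>l\<in>{i, j}. X l \<omega>) = (\<Prod>l\<in>{i, j}. expectation (X l))"
    using assms by (intro indep_vars_lebesgue_integral) auto
  then show ?thesis using assms by simp
qed

lemma (in prob_space) lqg_noises_moments:
  assumes "lqg_noises M Q R s2 w v e"
  shows "square_integrable M (w k)" "square_integrable M (v k)" "square_integrable M (e k)"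
    and "expectation (\<lambda>\<omega>. (e k \<omega>)\<^sup>2) = s2"
    and "expectation (\<lambda>\<omega>. w j \<omega> * e k \<omega>) = 0"
    and "expectation (\<lambda>\<omega>. v j \<omega> * e k \<omega>) = 0"
    and "j \<noteq> k \<Longrightarrow> expectation (\<lambda>\<omega>. e j \<omega> * e k \<omega>) = 0"
proof -
  let ?X = "case_sum w (case_sum v e)"
  have g: "gaussian_rv M (w k) Q" "gaussian_rv M (v k) R" "gaussian_rv M (e k) s2" for k
    using assms by (auto simp: lqg_noises_def)
  note moments = gaussian_rv_moments[OF g(1)] gaussian_rv_moments[OF g(2)] gaussian_rv_moments[OF g(3)]
  have int: "integrable M (w k)" "integrable M (v k)" "integrable M (e k)" for k
    using moments by (auto simp: square_integrable_def intro: square_integrable_imp_integrable)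
  have ind: "indep_vars (\<lambda>_. borel) ?X UNIV"
    using assms by (simp add: lqg_noises_def)
  show "square_integrable M (w k)" "square_integrable M (v k)" "square_integrable M (e k)"
    "expectation (\<lambda>\<omega>. (e k \<omega>)\<^sup>2) = s2"
    using moments by auto
  show "expectation (\<lambda>\<omega>. w j \<omega> * e k \<omega>) = 0"
    using indep_centered_uncorrelated[OF ind, of "Inl j" "Inr (Inr k)"] int moments by simp
  show "expectation (\<lambda>\<omega>. v j \<omega> * e k \<omega>) = 0"
    using indep_centered_uncorrelated[OF ind, of "Inr (Inl j)" "Inr (Inr k)"] int moments by simp
  show "expectation (\<lambda>\<omega>. e j \<omega> * e k \<omega>) = 0" if "j \<noteq> k"
    using indep_centered_uncorrelated[OF ind, of "Inr (Inr j)" "Inr (Inr k)"] int moments that by simp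
qed

section \<open>Stability from the Riccati equations\<close>

text \<open>
  In closed-loop form the equations read \<open>P = a\<^sup>2 P + Q + A\<^sup>2 K\<^sup>2 R\<close> and
  \<open>S = F\<^sup>2 S + W + L\<^sup>2 U\<close>, so that the positivity of \<open>P\<close>, \<open>Q\<close>, \<open>S\<close> and \<open>W\<close> bounds the poles.
\<close>

lemma kalman_error_pole_stable:
  assumes "Q > 0" "R > 0" "P > 0"
    and ric: "P = A\<^sup>2 * P + Q - A\<^sup>2 * C\<^sup>2 * P\<^sup>2 / (C\<^sup>2 * P + R)"
  shows "\<bar>A * (1 - kalman_gain C R P * C)\<bar> < 1"
proof -
  define D where "D = C\<^sup>2 * P + R"
  have D: "D > 0" unfolding D_def using assms by (intro add_nonneg_pos) auto
  define K where "K = kalman_gain C R P"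
  have KD: "K * D = C * P" using D by (simp add: K_def kalman_gain_def D_def)
  have frac: "C\<^sup>2 * P\<^sup>2 / D = K\<^sup>2 * D"
    using D KD by (metis (no_types, lifting) nonzero_eq_divide_eq less_irrefl mult.assoc
        power2_eq_square power_mult_distrib)
  have "(1 - K * C)\<^sup>2 * P + K\<^sup>2 * R = P - 2 * C * P * K + K\<^sup>2 * D"
    by (simp add: D_def power2_eq_square algebra_simps)
  also have "\<dots> = P - K\<^sup>2 * D"
    using KD by (simp add: power2_eq_square algebra_simps flip: KD)
  finally have "A\<^sup>2 * ((1 - K * C)\<^sup>2 * P + K\<^sup>2 * R) = A\<^sup>2 * (P - C\<^sup>2 * P\<^sup>2 / D)"
    using frac by simp
  moreover have "P = A\<^sup>2 * (P - C\<^sup>2 * P\<^sup>2 / D) + Q"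
    using ric by (simp add: D_def algebra_simps)
  moreover have "A\<^sup>2 * ((1 - K * C)\<^sup>2 * P + K\<^sup>2 * R) = (A * (1 - K * C))\<^sup>2 * P + A\<^sup>2 * K\<^sup>2 * R"
    by (simp add: power_mult_distrib distrib_left mult.assoc)
  ultimately have "P = (A * (1 - K * C))\<^sup>2 * P + (A\<^sup>2 * K\<^sup>2 * R + Q)"
    by linarith
  moreover have "A\<^sup>2 * K\<^sup>2 * R + Q > 0"
    using assms by (intro add_nonneg_pos) auto
  ultimately have "(A * (1 - K * C))\<^sup>2 * P < 1 * P" by linarith
  then have "(A * (1 - K * C))\<^sup>2 < 1" using \<open>P > 0\<close> by simp
  then show ?thesis by (simp add: K_def abs_square_less_1)
qed

lemma lqg_closed_loop_pole_stable:
  assumes "W > 0" "U > 0" "S > 0"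
    and ric: "S = A\<^sup>2 * S + W - A\<^sup>2 * B\<^sup>2 * S\<^sup>2 / (B\<^sup>2 * S + U)"
  shows "\<bar>A + B * lqg_gain A B U S\<bar> < 1"
proof -
  define D where "D = B\<^sup>2 * S + U"
  have D: "D > 0" unfolding D_def using assms by (intro add_nonneg_pos) auto
  define L where "L = lqg_gain A B U S"
  have LD: "L * D = - (A * B * S)" using D by (simp add: L_def lqg_gain_def D_def)
  have frac: "A\<^sup>2 * B\<^sup>2 * S\<^sup>2 / D = L\<^sup>2 * D"
  proof -
    have "A\<^sup>2 * B\<^sup>2 * S\<^sup>2 = (L * D)\<^sup>2" by (simp add: LD power_mult_distrib)
    then show ?thesis using D by (simp add: power2_eq_square)
  qed
  have "(A + B * L)\<^sup>2 * S + L\<^sup>2 * U = A\<^sup>2 * S + 2 * L * (A * B * S) + L\<^sup>2 * D"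
    by (simp add: D_def power2_eq_square algebra_simps)
  also have "A * B * S = - (L * D)" using LD by simp
  also have "A\<^sup>2 * S + 2 * L * (- (L * D)) + L\<^sup>2 * D = A\<^sup>2 * S - L\<^sup>2 * D"
    by (simp add: power2_eq_square)
  finally have "S = (A + B * L)\<^sup>2 * S + (L\<^sup>2 * U + W)"
    using ric frac by (simp add: D_def)
  moreover have "L\<^sup>2 * U + W > 0"
    using assms by (intro add_nonneg_pos) auto
  ultimately have "(A + B * L)\<^sup>2 * S < 1 * S" by linarith
  then have "(A + B * L)\<^sup>2 < 1" using \<open>S > 0\<close> by simp
  then show ?thesis by (simp add: L_def abs_square_less_1)
qed

text \<open>
  The costate form of the LQG control: the feedback acts on the current estimate through the
  prediction of the next state that it brings about.
\<close>

lemma lqg_gain_costate: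
  assumes "U > 0" "S > 0"
  shows "lqg_gain A B U S = - (B * S / U) * (A + B * lqg_gain A B U S)"
proof -
  define D where "D = B\<^sup>2 * S + U"
  have D: "D > 0" unfolding D_def using assms by (intro add_nonneg_pos) auto
  define L where "L = lqg_gain A B U S"
  have LD: "L * D = - (A * B * S)" using D by (simp add: L_def lqg_gain_def D_def)
  have "(A + B * L) * D = A * D + B * (L * D)" by (simp add: algebra_simps)
  also have "\<dots> = A * U"
    unfolding LD by (simp add: D_def power2_eq_square algebra_simps)
  finally have "- (B * S / U) * (A + B * L) * D = - (B * S / U) * (A * U)"
    by (simp only: mult.assoc)
  also have "\<dots> = L * D" using \<open>U > 0\<close> LD by simp
  finally have "- (B * S / U) * (A + B * L) = L"
    by (rule mult_right_cancel[THEN iffD1, rotated]) (use D in simp)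
  then show ?thesis unfolding L_def by (rule sym)
qed

section \<open>The steady-state loop\<close>

lemma steady_state_loop_square_integrable:
  assumes "steady_state_loop M A B C R P w v x y u xp xf"
  shows "square_integrable M (x k)" "square_integrable M (xp k)"
  using assms by (auto simp: steady_state_loop_def square_integrable_def)

lemma steady_state_loop_second_moments:
  assumes "steady_state_loop M A B C R P w v x y u xp xf"
  shows "(\<integral>\<omega>. (x k \<omega>)\<^sup>2 \<partial>M) = (\<integral>\<omega>. (x 0 \<omega>)\<^sup>2 \<partial>M)"
    and "(\<integral>\<omega>. (xp k \<omega>)\<^sup>2 \<partial>M) = (\<integral>\<omega>. (xp 0 \<omega>)\<^sup>2 \<partial>M)"
    and "(\<integral>\<omega>. (x k \<omega> - xp k \<omega>)\<^sup>2 \<partial>M) = P"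
proof -
  have meas: "x k \<in> borel_measurable M" "xp k \<in> borel_measurable M" for k
    using assms by (auto simp: steady_state_loop_def)
  let ?D = "\<lambda>k. distr M (borel \<Otimes>\<^sub>M borel) (\<lambda>\<omega>. (x k \<omega>, xp k \<omega>))"
  have D: "?D k = ?D 0" for k
    using assms unfolding steady_state_loop_def by blast
  have "(\<integral>\<omega>. (x k \<omega>)\<^sup>2 \<partial>M) = (\<integral>z. (fst z)\<^sup>2 \<partial>?D k)" for k
    using meas by (subst integral_distr) auto
  then show "(\<integral>\<omega>. (x k \<omega>)\<^sup>2 \<partial>M) = (\<integral>\<omega>. (x 0 \<omega>)\<^sup>2 \<partial>M)"
    by (simp only: D[of k])
  have "(\<integral>\<omega>. (xp k \<omega>)\<^sup>2 \<partial>M) = (\<integral>z. (snd z)\<^sup>2 \<partial>?D k)" for k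
    using meas by (subst integral_distr) auto
  then show "(\<integral>\<omega>. (xp k \<omega>)\<^sup>2 \<partial>M) = (\<integral>\<omega>. (xp 0 \<omega>)\<^sup>2 \<partial>M)"
    by (simp only: D[of k])
  show "(\<integral>\<omega>. (x k \<omega> - xp k \<omega>)\<^sup>2 \<partial>M) = P"
    using assms by (simp add: steady_state_loop_def)
qed

lemma steady_state_loop_error_recursion:
  assumes "steady_state_loop M A B C R P w v x y u xp xf"
  defines "K \<equiv> kalman_gain C R P"
  shows "AE \<omega> in M. x (k + 1) \<omega> - xp (k + 1) \<omega>
    = A * (1 - K * C) * (x k \<omega> - xp k \<omega>) + (w k \<omega> - A * K * v k \<omega>)"
proof -
  have "AE \<omega> in M. x (k + 1) \<omega> = A * x k \<omega> + B * u k \<omega> + w k \<omega>"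
    "AE \<omega> in M. y k \<omega> = C * x k \<omega> + v k \<omega>"
    "AE \<omega> in M. xp (k + 1) \<omega> = A * xf k \<omega> + B * u k \<omega>"
    "AE \<omega> in M. xf k \<omega> = xp k \<omega> + K * (y k \<omega> - C * xp k \<omega>)"
    using assms by (auto simp: steady_state_loop_def)
  then show ?thesis
    by eventually_elim (simp add: algebra_simps)
qed

lemma steady_state_loop_prediction_recursion:
  assumes "steady_state_loop M A B C R P w v x y u xp xf"
    and "\<forall>k. AE \<omega> in M. u k \<omega> = L * xf k \<omega> + e k \<omega>"
  defines "K \<equiv> kalman_gain C R P"
  shows "AE \<omega> in M. xp (k + 1) \<omega> = (A + B * L) * xp k \<omega>
      + ((A + B * L) * K * C * (x k \<omega> - xp k \<omega>) + (A + B * L) * K * v k \<omega> + B * e k \<omega>)"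
    and "AE \<omega> in M. u k \<omega> = L * xp k \<omega>
      + (L * K * C * (x k \<omega> - xp k \<omega>) + L * K * v k \<omega> + e k \<omega>)"
proof -
  have eqs: "AE \<omega> in M. y k \<omega> = C * x k \<omega> + v k \<omega>"
    "AE \<omega> in M. xp (k + 1) \<omega> = A * xf k \<omega> + B * u k \<omega>"
    "AE \<omega> in M. xf k \<omega> = xp k \<omega> + K * (y k \<omega> - C * xp k \<omega>)"
    "AE \<omega> in M. u k \<omega> = L * xf k \<omega> + e k \<omega>"
    using assms by (auto simp: steady_state_loop_def)
  then show "AE \<omega> in M. xp (k + 1) \<omega> = (A + B * L) * xp k \<omega>
      + ((A + B * L) * K * C * (x k \<omega> - xp k \<omega>) + (A + B * L) * K * v k \<omega> + B * e k \<omega>)"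
    by eventually_elim (simp add: algebra_simps)
  from eqs(1,3,4) show "AE \<omega> in M. u k \<omega> = L * xp k \<omega>
      + (L * K * C * (x k \<omega> - xp k \<omega>) + L * K * v k \<omega> + e k \<omega>)"
  proof eventually_elim
    case (elim \<omega>)
    show ?case unfolding elim(3) elim(2) elim(1) by (simp add: algebra_simps)
  qed
qed

text \<open>
  Both loops solve the same stable error recursion, whose solution of bounded second moment is
  unique; the control is the only difference, and it cancels.
\<close>

lemma steady_state_errors_agree:
  assumes loop1: "steady_state_loop M A B C R P w v x1 y1 u1 xp1 xf1"
    and loop2: "steady_state_loop M A B C R P w v x2 y2 u2 xp2 xf2"
    and stable: "\<bar>A * (1 - kalman_gain C R P * C)\<bar> < 1"
  shows "AE \<omega> in M. x2 k \<omega> - xp2 k \<omega> = x1 k \<omega> - xp1 k \<omega>"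
proof -
  let ?d1 = "\<lambda>k \<omega>. x1 k \<omega> - xp1 k \<omega>" and ?d2 = "\<lambda>k \<omega>. x2 k \<omega> - xp2 k \<omega>"
  have sq: "square_integrable M (?d1 k)" "square_integrable M (?d2 k)" for k
    using steady_state_loop_square_integrable[OF loop1] steady_state_loop_square_integrable[OF loop2]
    by (auto intro: square_integrable_diff)
  have "AE \<omega> in M. ?d2 k \<omega> - ?d1 k \<omega> = 0"
  proof (rule stable_homogeneous_recursion_zero[where a = "A * (1 - kalman_gain C R P * C)" and b = "4 * P"])
    show "square_integrable M (\<lambda>\<omega>. ?d2 j \<omega> - ?d1 j \<omega>)" for j
      by (rule square_integrable_diff[OF sq(2) sq(1)])
    show "AE \<omega> in M. ?d2 (j + 1) \<omega> - ?d1 (j + 1) \<omega>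
        = A * (1 - kalman_gain C R P * C) * (?d2 j \<omega> - ?d1 j \<omega>)" for j
      using steady_state_loop_error_recursion[OF loop1, of j]
        steady_state_loop_error_recursion[OF loop2, of j]
      by eventually_elim (simp add: algebra_simps)
    show "\<bar>A * (1 - kalman_gain C R P * C)\<bar> < 1" by (rule stable)
    fix j
    have "(\<integral>\<omega>. (?d2 j \<omega> - ?d1 j \<omega>)\<^sup>2 \<partial>M) \<le> (\<integral>\<omega>. 2 * (?d2 j \<omega>)\<^sup>2 + 2 * (?d1 j \<omega>)\<^sup>2 \<partial>M)"
      using sq square_integrable_diff[OF sq(2) sq(1)]
      by (intro integral_mono) (auto simp: square_integrable_def square_diff_le_twice_squares)
    also have "\<dots> = 4 * P"
      using sq steady_state_loop_second_moments(3)[OF loop1] steady_state_loop_second_moments(3)[OF loop2]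
      by (simp add: square_integrable_def)
    finally show "(\<integral>\<omega>. (?d2 j \<omega> - ?d1 j \<omega>)\<^sup>2 \<partial>M) \<le> 4 * P" .
  qed
  then show ?thesis by eventually_elim simp
qed

text \<open>
  Only \<open>w\<close> and \<open>v\<close> drive the nominal loop.  The correlations vanish for the error first, and then for
  the prediction, which has the error among its inputs.
\<close>

lemma nominal_loop_uncorrelated:
  assumes loop: "steady_state_loop M A B C R P w v x y u xp xf"
    and u: "\<forall>k. AE \<omega> in M. u k \<omega> = L * xf k \<omega>"
    and stable: "\<bar>A * (1 - kalman_gain C R P * C)\<bar> < 1" "\<bar>A + B * L\<bar> < 1"
    and w: "\<And>j. square_integrable M (w j)" and v: "\<And>j. square_integrable M (v j)"
    and G: "square_integrable M G"
    and wG: "\<And>j. (\<integral>\<omega>. w j \<omega> * G \<omega> \<partial>M) = 0" and vG: "\<And>j. (\<integral>\<omega>. v j \<omega> * G \<omega> \<partial>M) = 0"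
  shows "(\<integral>\<omega>. xp k \<omega> * G \<omega> \<partial>M) = 0" and "(\<integral>\<omega>. x k \<omega> * G \<omega> \<partial>M) = 0"
proof -
  let ?K = "kalman_gain C R P" and ?F = "A + B * L"
  let ?d = "\<lambda>k \<omega>. x k \<omega> - xp k \<omega>"
  note sq = steady_state_loop_square_integrable[OF loop]
  have d: "square_integrable M (?d k)" for k
    using sq by (intro square_integrable_diff)
  have dG: "(\<integral>\<omega>. ?d k \<omega> * G \<omega> \<partial>M) = 0" for k
  proof (rule stable_recursion_uncorrelated[where a = "A * (1 - ?K * C)" and b = P
        and N = "\<lambda>j \<omega>. 1 * w j \<omega> + (- (A * ?K)) * v j \<omega>"])
    show "square_integrable M (\<lambda>\<omega>. 1 * w j \<omega> + (- (A * ?K)) * v j \<omega>)" for j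
      using w v by (intro square_integrable_add square_integrable_cmult)
    show "AE \<omega> in M. ?d (j + 1) \<omega> = A * (1 - ?K * C) * ?d j \<omega> + (1 * w j \<omega> + (- (A * ?K)) * v j \<omega>)" for j
      using steady_state_loop_error_recursion[OF loop, of j] by simp
    show "(\<integral>\<omega>. (1 * w j \<omega> + (- (A * ?K)) * v j \<omega>) * G \<omega> \<partial>M) = 0" for j
      unfolding integral_lincomb_mult[OF w v G] wG vG by simp
    show "(\<integral>\<omega>. (?d j \<omega>)\<^sup>2 \<partial>M) \<le> P" for j
      using steady_state_loop_second_moments(3)[OF loop] by simp
  qed (use d G stable in auto)
  have u0: "\<forall>k. AE \<omega> in M. u k \<omega> = L * xf k \<omega> + (\<lambda>_ _. 0) k \<omega>"
    using u by simp
  show xpG: "(\<integral>\<omega>. xp k \<omega> * G \<omega> \<partial>M) = 0" for k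
  proof (rule stable_recursion_uncorrelated[where a = ?F and b = "\<integral>\<omega>. (xp 0 \<omega>)\<^sup>2 \<partial>M"
        and N = "\<lambda>j \<omega>. (?F * ?K * C) * ?d j \<omega> + (?F * ?K) * v j \<omega>"])
    show "square_integrable M (\<lambda>\<omega>. (?F * ?K * C) * ?d j \<omega> + (?F * ?K) * v j \<omega>)" for j
      using d v by (intro square_integrable_add square_integrable_cmult)
    show "AE \<omega> in M. xp (j + 1) \<omega> = ?F * xp j \<omega> + ((?F * ?K * C) * ?d j \<omega> + (?F * ?K) * v j \<omega>)" for j
      using steady_state_loop_prediction_recursion(1)[OF loop u0, of j] by simp
    show "(\<integral>\<omega>. ((?F * ?K * C) * ?d j \<omega> + (?F * ?K) * v j \<omega>) * G \<omega> \<partial>M) = 0" for j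
      unfolding integral_lincomb_mult[OF d v G] dG vG by simp
    show "(\<integral>\<omega>. (xp j \<omega>)\<^sup>2 \<partial>M) \<le> (\<integral>\<omega>. (xp 0 \<omega>)\<^sup>2 \<partial>M)" for j
      using steady_state_loop_second_moments(2)[OF loop, of j] by simp
  qed (use sq G stable in auto)
  show "(\<integral>\<omega>. x k \<omega> * G \<omega> \<partial>M) = 0"
    using integral_lincomb_mult[OF sq(2)[of k] d[of k] G, of 1 1] xpG[of k] dG[of k] by simp
qed

text \<open>
  This is how the nominal control gets a constant second moment: stationarity is only assumed for
  the state and its prediction, and here the control is a multiple of the next prediction.
\<close>

lemma nominal_control_costate:
  assumes loop: "steady_state_loop M A B C R P w v x y u xp xf"
    and u: "\<forall>k. AE \<omega> in M. u k \<omega> = lqg_gain A B U S * xf k \<omega>"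
    and "U > 0" "S > 0"
  shows "AE \<omega> in M. u k \<omega> = - (B * S / U) * xp (k + 1) \<omega>"
proof -
  define L where "L = lqg_gain A B U S"
  have L: "L = - (B * S / U) * (A + B * L)"
    unfolding L_def by (rule lqg_gain_costate) fact+
  have "AE \<omega> in M. xp (k + 1) \<omega> = A * xf k \<omega> + B * u k \<omega>" "AE \<omega> in M. u k \<omega> = L * xf k \<omega>"
    using loop u by (auto simp: steady_state_loop_def L_def)
  then show ?thesis
  proof eventually_elim
    case (elim \<omega>)
    then have "xp (k + 1) \<omega> = (A + B * L) * xf k \<omega>" by (simp add: algebra_simps)
    then show ?case using elim(2) L by (metis mult.assoc)
  qed
qed

lemma lqg_average_cost_stationary:
  assumes x: "\<And>k. square_integrable M (x k)" and u: "\<And>k. square_integrable M (u k)"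
    and c: "\<And>k. W * (\<integral>\<omega>. (x k \<omega>)\<^sup>2 \<partial>M) + U * (\<integral>\<omega>. (u k \<omega>)\<^sup>2 \<partial>M) = c"
  shows "lqg_average_cost M W U x u = (\<lambda>_. c)"
proof
  fix T
  have int: "integrable M (\<lambda>\<omega>. (x k \<omega>)\<^sup>2)" "integrable M (\<lambda>\<omega>. (u k \<omega>)\<^sup>2)" for k
    using x u by (auto simp: square_integrable_def)
  have "lqg_average_cost M W U x u T = 1 / (2 * real T + 1) * (\<Sum>k = - int T..int T. c)"
    unfolding lqg_average_cost_def using int by (simp add: Bochner_Integration.integral_sum c)
  also have "\<dots> = c" by (simp add: nat_add_distrib add.commute)
  finally show "lqg_average_cost M W U x u T = c" .
qed

section \<open>The cost of the watermark\<close>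

theorem theorem2:
  fixes M :: "'a measure"
    and A B C Q R W U P S L \<sigma>\<^sub>e \<Delta>LQG :: real
    and w v e :: "int \<Rightarrow> 'a \<Rightarrow> real"
    and x\<^sub>n y\<^sub>n u\<^sub>n xp\<^sub>n xf\<^sub>n :: "int \<Rightarrow> 'a \<Rightarrow> real"
    and x\<^sub>w y\<^sub>w u\<^sub>w xp\<^sub>w xf\<^sub>w :: "int \<Rightarrow> 'a \<Rightarrow> real"
  assumes "prob_space M"
    and "B \<noteq> 0" and "C \<noteq> 0" and "Q > 0" and "R > 0" and "W > 0" and "U > 0"
    and "stabilizable A B" and "detectable A C"
    and "P > 0" and "P = A\<^sup>2 * P + Q - A\<^sup>2 * C\<^sup>2 * P\<^sup>2 / (C\<^sup>2 * P + R)"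
    and "S > 0" and "S = A\<^sup>2 * S + W - A\<^sup>2 * B\<^sup>2 * S\<^sup>2 / (B\<^sup>2 * S + U)"
    and "L = lqg_gain A B U S"
    and "lqg_noises M Q R (\<sigma>\<^sub>e\<^sup>2) w v e"
    and "steady_state_loop M A B C R P w v x\<^sub>n y\<^sub>n u\<^sub>n xp\<^sub>n xf\<^sub>n"
    and "\<forall>k. AE \<omega> in M. u\<^sub>n k \<omega> = L * xf\<^sub>n k \<omega>"
    and "steady_state_loop M A B C R P w v x\<^sub>w y\<^sub>w u\<^sub>w xp\<^sub>w xf\<^sub>w"
    and "\<forall>k. AE \<omega> in M. u\<^sub>w k \<omega> = L * xf\<^sub>w k \<omega> + e k \<omega>"
    and "\<Delta>LQG = lqg_cost M W U x\<^sub>w u\<^sub>w - lqg_cost M W U x\<^sub>n u\<^sub>n"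
  shows "convergent (lqg_average_cost M W U x\<^sub>n u\<^sub>n) \<and>
         convergent (lqg_average_cost M W U x\<^sub>w u\<^sub>w) \<and>
         \<sigma>\<^sub>e\<^sup>2 = \<Delta>LQG / (U + B\<^sup>2 * (W + L\<^sup>2 * U) / (1 - (A + B * L)\<^sup>2))"
proof -
  interpret prob_space M by fact
  define K where "K = kalman_gain C R P"
  define F where "F = A + B * L"
  note loop_n = assms(16) and u_n = assms(17) and loop_w = assms(18) and u_w = assms(19)
  note noise = lqg_noises_moments[OF assms(15)]
  have stable: "\<bar>A * (1 - kalman_gain C R P * C)\<bar> < 1" "\<bar>A + B * L\<bar> < 1"
    using kalman_error_pole_stable[OF assms(4,5,10,11)] lqg_closed_loop_pole_stable[OF assms(6,7,12,13)]
      assms(14) by auto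
  have F: "\<bar>F\<bar> < 1" using stable by (simp add: F_def)
  note sq_n = steady_state_loop_square_integrable[OF loop_n]
  note sq_w = steady_state_loop_square_integrable[OF loop_w]

  define r where "r k \<omega> = xp\<^sub>w k \<omega> - xp\<^sub>n k \<omega>" for k \<omega>
  have sq_r: "square_integrable M (r k)" for k
    unfolding r_def using sq_n sq_w by (intro square_integrable_diff)
  \<comment> \<open>The nominal loop is the loop with watermark zero.\<close>
  have u_n0: "\<forall>k. AE \<omega> in M. u\<^sub>n k \<omega> = L * xf\<^sub>n k \<omega> + (\<lambda>_ _. 0) k \<omega>"
    using u_n by simp
  note errors_agree = steady_state_errors_agree[OF loop_n loop_w stable(1)]
  have r_rec: "AE \<omega> in M. r (k + 1) \<omega> = F * r k \<omega> + B * e k \<omega>" for k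
    using steady_state_loop_prediction_recursion(1)[OF loop_n u_n0, of k]
      steady_state_loop_prediction_recursion(1)[OF loop_w u_w, of k] errors_agree[of k]
  proof eventually_elim
    case (elim \<omega>)
    show ?case
      unfolding r_def elim(1) elim(2) elim(3) F_def by (simp add: algebra_simps)
  qed
  have x_split: "AE \<omega> in M. x\<^sub>w k \<omega> = x\<^sub>n k \<omega> + r k \<omega>" for k
    using errors_agree[of k] by eventually_elim (simp add: r_def)
  have u_split: "AE \<omega> in M. u\<^sub>w k \<omega> = u\<^sub>n k \<omega> + (L * r k \<omega> + e k \<omega>)" for k
    using steady_state_loop_prediction_recursion(2)[OF loop_n u_n0, of k]
      steady_state_loop_prediction_recursion(2)[OF loop_w u_w, of k] errors_agree[of k]
  proof eventually_elim
    case (elim \<omega>)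
    show ?case
      unfolding r_def elim(1) elim(2) elim(3) by (simp add: algebra_simps)
  qed

  have r_bound: "expectation (\<lambda>\<omega>. (r k \<omega>)\<^sup>2)
      \<le> 2 * expectation (\<lambda>\<omega>. (xp\<^sub>w 0 \<omega>)\<^sup>2) + 2 * expectation (\<lambda>\<omega>. (xp\<^sub>n 0 \<omega>)\<^sup>2)" for k
  proof -
    have "expectation (\<lambda>\<omega>. (r k \<omega>)\<^sup>2) \<le> expectation (\<lambda>\<omega>. 2 * (xp\<^sub>w k \<omega>)\<^sup>2 + 2 * (xp\<^sub>n k \<omega>)\<^sup>2)"
      using sq_r[of k] sq_n(2)[of k] sq_w(2)[of k]
      by (intro integral_mono) (auto simp: square_integrable_def r_def square_diff_le_twice_squares)
    also have "\<dots> = 2 * expectation (\<lambda>\<omega>. (xp\<^sub>w k \<omega>)\<^sup>2) + 2 * expectation (\<lambda>\<omega>. (xp\<^sub>n k \<omega>)\<^sup>2)"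
      using sq_n(2)[of k] sq_w(2)[of k] by (simp add: square_integrable_def)
    finally show ?thesis
      using steady_state_loop_second_moments(2)[OF loop_n, of k]
        steady_state_loop_second_moments(2)[OF loop_w, of k] by simp
  qed
  have Be: "square_integrable M (\<lambda>\<omega>. B * e k \<omega>)" for k
    by (rule square_integrable_cmult[OF noise(3)])
  \<comment> \<open>Only inputs before \<open>k\<close> enter \<open>r k\<close>; with \<open>G = e k\<close> this uses whiteness of the watermark, with
    \<open>G\<close> a nominal state its independence of the other noises.\<close>
  have r_uncorrelated: "expectation (\<lambda>\<omega>. r k \<omega> * G \<omega>) = 0"
    if "square_integrable M G" "\<And>j. j < k \<Longrightarrow> expectation (\<lambda>\<omega>. e j \<omega> * G \<omega>) = 0" for k G
    by (rule stable_recursion_uncorrelated[where N = "\<lambda>j \<omega>. B * e j \<omega>",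
          OF sq_r Be that(1) r_rec F r_bound])
      (simp add: mult.assoc that(2))
  have r_e: "expectation (\<lambda>\<omega>. r k \<omega> * e k \<omega>) = 0" for k
    by (rule r_uncorrelated) (use noise in auto)
  have r_var: "expectation (\<lambda>\<omega>. (r k \<omega>)\<^sup>2) = B\<^sup>2 * \<sigma>\<^sub>e\<^sup>2 / (1 - F\<^sup>2)" for k
    by (rule white_noise_response_second_moment[where e = e, OF sq_r noise(3) r_rec F r_bound noise(4) r_e])

  have n_e: "expectation (\<lambda>\<omega>. xp\<^sub>n k \<omega> * e j \<omega>) = 0" "expectation (\<lambda>\<omega>. x\<^sub>n k \<omega> * e j \<omega>) = 0" for k j
    using nominal_loop_uncorrelated[OF loop_n u_n stable noise(1,2) noise(3) noise(5,6)] by auto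
  have n_r: "expectation (\<lambda>\<omega>. xp\<^sub>n k \<omega> * r j \<omega>) = 0" "expectation (\<lambda>\<omega>. x\<^sub>n k \<omega> * r j \<omega>) = 0" for k j
    using r_uncorrelated[OF sq_n(2)[of k], of j] r_uncorrelated[OF sq_n(1)[of k], of j] n_e
    by (simp_all add: mult.commute)

  define c where "c = - (B * S / U)"
  have u_meas: "u\<^sub>n k \<in> borel_measurable M" "u\<^sub>w k \<in> borel_measurable M" for k
    using loop_n loop_w by (auto simp: steady_state_loop_def)
  have x_meas: "x\<^sub>n k \<in> borel_measurable M" "x\<^sub>w k \<in> borel_measurable M" "xp\<^sub>n k \<in> borel_measurable M"
    "r k \<in> borel_measurable M" "e k \<in> borel_measurable M" for k
    using sq_n sq_w sq_r noise(3) by (auto simp: square_integrable_def)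
  have u_costate: "AE \<omega> in M. u\<^sub>n k \<omega> = c * xp\<^sub>n (k + 1) \<omega>" for k
    unfolding c_def using nominal_control_costate[OF loop_n _ assms(7,12)] u_n assms(14) by simp
  have sq_u: "square_integrable M (u\<^sub>n k)" for k
    by (rule square_integrable_cong_AE[OF square_integrable_cmult[OF sq_n(2)] u_meas(1) u_costate])
  have u_moment: "expectation (\<lambda>\<omega>. (u\<^sub>n k \<omega>)\<^sup>2) = c\<^sup>2 * expectation (\<lambda>\<omega>. (xp\<^sub>n 0 \<omega>)\<^sup>2)" for k
  proof -
    have "expectation (\<lambda>\<omega>. (u\<^sub>n k \<omega>)\<^sup>2) = expectation (\<lambda>\<omega>. (c * xp\<^sub>n (k + 1) \<omega>)\<^sup>2)"
      using u_meas x_meas u_costate by (intro integral_square_cong_AE) auto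
    then show ?thesis
      using steady_state_loop_second_moments(2)[OF loop_n, of "k + 1"] by (simp add: power_mult_distrib)
  qed
  \<comment> \<open>The change of the control; its two summands are uncorrelated with each other and with \<open>u\<^sub>n\<close>.\<close>
  define h where "h k \<omega> = L * r k \<omega> + e k \<omega>" for k \<omega>
  have sq_h: "square_integrable M (h k)" for k
    unfolding h_def using sq_r noise(3) by (intro square_integrable_add square_integrable_cmult)
  have h_moment: "expectation (\<lambda>\<omega>. (h k \<omega>)\<^sup>2) = L\<^sup>2 * (B\<^sup>2 * \<sigma>\<^sub>e\<^sup>2 / (1 - F\<^sup>2)) + \<sigma>\<^sub>e\<^sup>2" for k
    using integral_square_add[OF square_integrable_cmult[OF sq_r[of k], of L] noise(3)[of k]]
      r_var[of k] noise(4)[of k] r_e[of k]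
    by (simp add: h_def power_mult_distrib mult.assoc)
  have u_h: "expectation (\<lambda>\<omega>. u\<^sub>n k \<omega> * h k \<omega>) = 0" for k
  proof -
    have "expectation (\<lambda>\<omega>. h k \<omega> * xp\<^sub>n (k + 1) \<omega>) = 0"
      using integral_lincomb_mult[OF sq_r[of k] noise(3)[of k] sq_n(2)[of "k + 1"], of L 1]
        n_r(1)[of "k + 1" k] n_e(1)[of "k + 1" k]
      by (simp add: h_def mult.commute)
    moreover have "expectation (\<lambda>\<omega>. u\<^sub>n k \<omega> * h k \<omega>) = expectation (\<lambda>\<omega>. c * (h k \<omega> * xp\<^sub>n (k + 1) \<omega>))"
      using u_meas x_meas u_costate[of k] by (intro integral_cong_AE) (auto simp: h_def)
    ultimately show ?thesis by simp
  qed

  have xw_moment: "expectation (\<lambda>\<omega>. (x\<^sub>w k \<omega>)\<^sup>2)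
      = expectation (\<lambda>\<omega>. (x\<^sub>n 0 \<omega>)\<^sup>2) + B\<^sup>2 * \<sigma>\<^sub>e\<^sup>2 / (1 - F\<^sup>2)" for k
  proof -
    have "expectation (\<lambda>\<omega>. (x\<^sub>w k \<omega>)\<^sup>2) = expectation (\<lambda>\<omega>. (x\<^sub>n k \<omega> + r k \<omega>)\<^sup>2)"
      using x_meas x_split by (intro integral_square_cong_AE) auto
    then show ?thesis
      using integral_square_add[OF sq_n(1)[of k] sq_r[of k]] n_r(2)[of k k] r_var[of k]
        steady_state_loop_second_moments(1)[OF loop_n, of k] by simp
  qed
  have uw_moment: "expectation (\<lambda>\<omega>. (u\<^sub>w k \<omega>)\<^sup>2)
      = c\<^sup>2 * expectation (\<lambda>\<omega>. (xp\<^sub>n 0 \<omega>)\<^sup>2) + (L\<^sup>2 * (B\<^sup>2 * \<sigma>\<^sub>e\<^sup>2 / (1 - F\<^sup>2)) + \<sigma>\<^sub>e\<^sup>2)" for k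
  proof -
    have "expectation (\<lambda>\<omega>. (u\<^sub>w k \<omega>)\<^sup>2) = expectation (\<lambda>\<omega>. (u\<^sub>n k \<omega> + h k \<omega>)\<^sup>2)"
      using u_meas x_meas u_split by (intro integral_square_cong_AE) (auto simp: h_def)
    then show ?thesis
      using integral_square_add[OF sq_u[of k] sq_h[of k]] u_h[of k] u_moment[of k] h_moment[of k] by simp
  qed
  have sq_uw: "square_integrable M (u\<^sub>w k)" for k
    by (rule square_integrable_cong_AE[OF square_integrable_add[OF sq_u sq_h] u_meas(2)])
      (use u_split in \<open>simp add: h_def\<close>)

  define J where "J = W * expectation (\<lambda>\<omega>. (x\<^sub>n 0 \<omega>)\<^sup>2) + U * (c\<^sup>2 * expectation (\<lambda>\<omega>. (xp\<^sub>n 0 \<omega>)\<^sup>2))"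
  let ?g = "U + B\<^sup>2 * (W + L\<^sup>2 * U) / (1 - F\<^sup>2)"
  have cost_n: "lqg_average_cost M W U x\<^sub>n u\<^sub>n = (\<lambda>_. J)"
  proof (rule lqg_average_cost_stationary[OF sq_n(1) sq_u])
    show "W * expectation (\<lambda>\<omega>. (x\<^sub>n k \<omega>)\<^sup>2) + U * expectation (\<lambda>\<omega>. (u\<^sub>n k \<omega>)\<^sup>2) = J" for k
      unfolding J_def u_moment steady_state_loop_second_moments(1)[OF loop_n, of k] ..
  qed
  have cost_w: "lqg_average_cost M W U x\<^sub>w u\<^sub>w = (\<lambda>_. J + \<sigma>\<^sub>e\<^sup>2 * ?g)"
    by (rule lqg_average_cost_stationary[OF sq_w(1) sq_uw])
      (simp add: J_def xw_moment uw_moment algebra_simps add_divide_distrib)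
  have "\<Delta>LQG = \<sigma>\<^sub>e\<^sup>2 * ?g"
    using assms(20) by (simp add: lqg_cost_def cost_n cost_w lim_const)
  moreover have "?g > 0"
  proof -
    have "F\<^sup>2 < 1" using F by (simp add: abs_square_less_1)
    then have "B\<^sup>2 * (W + L\<^sup>2 * U) / (1 - F\<^sup>2) \<ge> 0"
      using \<open>W > 0\<close> \<open>U > 0\<close> by simp
    then show ?thesis using \<open>U > 0\<close> by linarith
  qed
  ultimately have "\<sigma>\<^sub>e\<^sup>2 = \<Delta>LQG / ?g" by simp
  then show ?thesis
    by (simp add: cost_n cost_w convergent_const F_def)
qed

end
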